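(* Let $p$ be a prime, $m$ a positive integer, and $n$ an even positive integer divisible by $p^m$. If $k$ is an integer divisible by $p$, then $S_{n-1,k-1}$, $P_{n-1,k-1}$, $Q_{n-1,k-1}$, $R_{n-1,k-1}$ and $D_{n-1,k-1}$ are all divisible by $p^m$.
   Context: For a permutation $A = a_1\cdots a_N$ of $[N]=\{1,\dots,N\}$, an ascent is an index $i$ ($1\le i\le N-1$) with $a_i<a_{i+1}$; $A$ is even/odd according to the parity of its number of inversions (pairs $i<j$ with $a_i>a_j$). For an integer $j$, let $B_{N,j}$, $C_{N,j}$ be the numbers of even, resp. odd, permutations of $[N]$ with exactly $j$ ascents (these are $0$ if $j<0$ or $j>N-1$), and $D_{N,j}=B_{N,j}-C_{N,j}$. A permutation is parity-alternate (a PAP) if its consecutive entries alternate between even and odd integers. Let $S_{N,j}$ be the number of PAPs of $[N]$ with exactly $j$ ascents, $P_{N,j}$ the number of even ones among them, $Q_{N,j}$ the number of odd ones, and $R_{N,j}=P_{N,j}-Q_{N,j}$. *)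

theory Defs
  imports "HOL-Combinatorics.Multiset_Permutations" "HOL-Computational_Algebra.Primes"
begin

text \<open>
  A permutation \<open>a\<^sub>1 \<dots> a\<^sub>N\<close> of \<open>{1..N}\<close> is the list of its values, an element of
  \<open>permutations_of_set {1..N}\<close>; \<open>a\<^sub>i\<close> is the list entry with index \<open>i - 1\<close>.
\<close>

definition ascents :: "nat list \<Rightarrow> nat set" where
  "ascents a = {i. Suc i < length a \<and> a ! i < a ! Suc i}"

definition inversions :: "nat list \<Rightarrow> (nat \<times> nat) set" where
  "inversions a = {(i, j). i < j \<and> j < length a \<and> a ! i > a ! j}"

definition parity_alternate :: "nat list \<Rightarrow> bool" where
  "parity_alternate a \<longleftrightarrow> (\<forall>i. Suc i < length a \<longrightarrow> (even (a ! i) \<longleftrightarrow> odd (a ! Suc i)))"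

definition perms_with_ascents :: "nat \<Rightarrow> int \<Rightarrow> nat list set" where
  "perms_with_ascents N j =
     {a \<in> permutations_of_set {1..N}. int (card (ascents a)) = j}"

definition B_count :: "nat \<Rightarrow> int \<Rightarrow> nat" where
  "B_count N j = card {a \<in> perms_with_ascents N j. even (card (inversions a))}"

definition C_count :: "nat \<Rightarrow> int \<Rightarrow> nat" where
  "C_count N j = card {a \<in> perms_with_ascents N j. odd (card (inversions a))}"

definition D_diff :: "nat \<Rightarrow> int \<Rightarrow> int" where
  "D_diff N j = int (B_count N j) - int (C_count N j)"

definition paps_with_ascents :: "nat \<Rightarrow> int \<Rightarrow> nat list set" where
  "paps_with_ascents N j = {a \<in> perms_with_ascents N j. parity_alternate a}"

definition S_count :: "nat \<Rightarrow> int \<Rightarrow> nat" where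
  "S_count N j = card (paps_with_ascents N j)"

definition P_count :: "nat \<Rightarrow> int \<Rightarrow> nat" where
  "P_count N j = card {a \<in> paps_with_ascents N j. even (card (inversions a))}"

definition Q_count :: "nat \<Rightarrow> int \<Rightarrow> nat" where
  "Q_count N j = card {a \<in> paps_with_ascents N j. odd (card (inversions a))}"

definition R_diff :: "nat \<Rightarrow> int \<Rightarrow> int" where
  "R_diff N j = int (P_count N j) - int (Q_count N j)"

end

theory Submission
  imports Defs "HOL-Number_Theory.Cong"
begin

text \<open>
  Prefixing a permutation \<open>a\<close> of \<open>{1..n - 1}\<close> with \<open>0\<close> and reading it cyclically gives a cyclic
  arrangement of the residues modulo \<open>n\<close>. Adding \<open>1\<close> to all residues is an action of the cyclic
  group of order \<open>n\<close> that preserves the number of cyclic ascents, and, on parity-alternate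
  permutations, also the alternation and the sign. If translation by \<open>n / p\<close> fixed an arrangement, it
  would act as a rotation by some \<open>r\<close>; the cyclic successive differences, reduced to \<open>{0..<n}\<close>, are
  then \<open>r\<close>-periodic with total \<open>n d\<close>, where \<open>d\<close> is the number of cyclic descents, so \<open>r\<close>
  consecutive ones sum to \<open>r d\<close>. But they also sum to \<open>- n / p\<close> modulo \<open>n\<close>, which is impossible
  when \<open>p\<close> divides \<open>d = n - k\<close>, as \<open>n\<close> divides \<open>r p\<close>. Hence all orbits have size divisible by \<open>p ^ m\<close>.

  For \<open>D\<close>, exchanging the least values \<open>v\<close> and \<open>v + 1\<close> that stand at positions of equal parity
  (hence not next to each other) is a sign-reversing, ascent-preserving involution on the
  permutations that are not parity-alternate, so \<open>D = R\<close>.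
\<close>

subsection \<open>Cyclic actions and cyclic sequences\<close>

text \<open>The classes of \<open>r\<close> below are orbits, and an orbit of size \<open>d\<close>
  satisfies \<open>n = d * c\<close>. If \<open>p\<close> divided \<open>c\<close>, then
  \<open>n div p\<close> would be a multiple of \<open>d\<close> and the corresponding iterate would
  fix a point. So \<open>c\<close> is coprime to \<open>p ^ m\<close>, and the whole prime power
  divides \<open>d\<close>.\<close>

lemma prime_power_dvd_card_of_cyclic_action:
  fixes f :: "'a \<Rightarrow> 'a"
  assumes fin: "finite X" and maps: "\<And>x. x \<in> X \<Longrightarrow> f x \<in> X"
    and per: "\<And>x. x \<in> X \<Longrightarrow> (f ^^ n) x = x"
    and "n > 0" and p: "prime p" and dvd: "p ^ m dvd n"
    and free: "\<And>x. x \<in> X \<Longrightarrow> (f ^^ (n div p)) x \<noteq> x"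
  shows "p ^ m dvd card X"
proof -
  define r where "r = {(x, y). x \<in> X \<and> (\<exists>i. y = (f ^^ i) x)}"
  have funpow_in: "(f ^^ i) x \<in> X" if "x \<in> X" for i x
    by (induction i) (use that maps in auto)
  have "equiv X r"
  proof (rule equivI)
    show "r \<subseteq> X \<times> X" using funpow_in by (auto simp: r_def)
    show "refl_on X r" by (auto simp: refl_on_def r_def intro: exI[of _ 0])
    show "sym r"
    proof (rule symI)
      fix x y assume "(x, y) \<in> r"
      then obtain i where x: "x \<in> X" and y: "y = (f ^^ i) x" by (auto simp: r_def)
      \<comment> \<open>Inverses are obtained by going forward: \<open>n * i - i\<close> more steps
        complete a multiple of the period \<open>n\<close>.\<close>
      have "(f ^^ (n * i - i)) y = (f ^^ (n * i - i + i)) x" by (simp add: y funpow_add)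
      also have "n * i - i + i = n * i" using \<open>n > 0\<close> by simp
      also have "(f ^^ (n * i)) x = x" using funpow_mod_eq[OF per[OF x], of "n * i"] by simp
      finally show "(y, x) \<in> r" using x y funpow_in by (auto simp: r_def intro: exI[of _ "n * i - i"])
    qed
    show "trans r"
      by (rule transI) (auto simp: r_def, metis comp_apply funpow_add)
  qed
  moreover have "p ^ m dvd card C" if C_quot: "C \<in> X // r" for C
  proof -
    obtain x where x: "x \<in> X" and C: "C = r `` {x}" using C_quot unfolding quotient_def by blast
    define d where "d = (LEAST d. d > 0 \<and> (f ^^ d) x = x)"
    have d: "d > 0" "(f ^^ d) x = x"
      using LeastI[of "\<lambda>d. d > 0 \<and> (f ^^ d) x = x" n] \<open>n > 0\<close> per[OF x] by (auto simp: d_def)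
    have min: "i = 0" if "i < d" "(f ^^ i) x = x" for i
      using that not_less_Least[of i "\<lambda>d. d > 0 \<and> (f ^^ d) x = x"] by (auto simp: d_def)
    have "C = (\<lambda>i. (f ^^ i) x) ` {..<d}"
    proof -
      have "(f ^^ i) x \<in> (\<lambda>i. (f ^^ i) x) ` {..<d}" for i
        using funpow_mod_eq[OF d(2), of i] d(1)
        by (metis image_eqI lessThan_iff mod_less_divisor)
      then show ?thesis using x by (auto simp: C r_def)
    qed
    moreover have "inj_on (\<lambda>i. (f ^^ i) x) {..<d}"
    proof (rule linorder_inj_onI)
      fix i j assume ij: "i < j" "i \<in> {..<d}" "j \<in> {..<d}"
      show "(f ^^ i) x \<noteq> (f ^^ j) x"
      proof
        assume eq: "(f ^^ i) x = (f ^^ j) x"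
        \<comment> \<open>Applying \<open>d - j\<close> further steps to both sides yields a return
          to \<open>x\<close> after fewer than \<open>d\<close> steps, against minimality.\<close>
        have "(f ^^ (d - j + i)) x = (f ^^ (d - j + j)) x"
          by (simp only: funpow_add o_apply eq)
        also have "\<dots> = x" using ij d by simp
        finally have "(f ^^ (d - j + i)) x = x" .
        moreover have "d - j + i < d" using ij by simp
        ultimately have "d - j + i = 0" by (rule min[rotated])
        then show False using ij by simp
      qed
    qed auto
    ultimately have card: "card C = d" by (simp add: card_image)
    have "(f ^^ (n mod d)) x = x" using funpow_mod_eq[OF d(2), of n] per[OF x] by simp
    then have "n mod d = 0" using d(1) by (intro min) simp_all
    then obtain c where c: "n = d * c" by (metis dvdE mod_0_imp_dvd)
    have "\<not> p dvd c"
    proof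
      assume "p dvd c"
      then obtain c' where "c = p * c'" ..
      then have "n div p = d * c'" using c p by (simp add: prime_gt_0_nat)
      then show False using free[OF x] funpow_mod_eq[OF d(2), of "d * c'"] by auto
    qed
    then have "coprime (p ^ m) c" using p by (simp add: prime_imp_coprime)
    then show ?thesis using dvd c card by (simp add: coprime_dvd_mult_left_iff)
  qed
  ultimately show ?thesis by (rule equiv_imp_dvd_card[OF fin])
qed

section \<open>Periodic integer sequences for which a translation acts as a rotation\<close>

lemma sum_periodic:
  fixes w :: "nat \<Rightarrow> int"
  assumes "\<And>i. w (i + r) = w i"
  shows "sum w {..<q * r} = int q * sum w {..<r}"
proof -
  have "sum w {..<m + r} = sum w {..<m} + sum w {..<r}" for m
    by (induction m) (use assms in auto)
  then have "sum w {..<Suc q * r} = sum w {..<q * r} + sum w {..<r}" for q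
    by (metis add.commute mult_Suc)
  then show ?thesis
    by (induction q) (simp_all add: distrib_right)
qed

text \<open>\<open>B\<close> reads a cyclic arrangement of the residues modulo \<open>n\<close>
  periodically along all naturals, so rotation by \<open>r\<close> is the index shift
  \<open>i + r\<close>. The contradiction is that \<open>n\<close> would divide both
  \<open>r * d + t\<close> and \<open>r * d\<close>, although \<open>0 < t < n\<close>.\<close>

lemma no_translation_symmetry:
  fixes B :: "nat \<Rightarrow> int" and n p r t :: nat
  assumes per: "\<And>i. B (i + n) = B i"
    and range: "\<And>i. 0 \<le> B i" "\<And>i. B i < int n"
    and inj: "\<And>i j. B i = B j \<Longrightarrow> i mod n = j mod n"
    and shift: "\<And>i. [B i = B (i + r) + int t] (mod int n)"
    and n: "n = p * t" and "t > 0" "p > 1"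
    and des: "p dvd card {i. i < n \<and> B (Suc i) < B i}"
  shows False
proof -
  \<comment> \<open>Reduction modulo \<open>n\<close> adds \<open>n\<close> to the plain difference
    exactly at the cyclic descents, and it makes \<open>w\<close> blind to translations of
    \<open>B\<close>.\<close>
  define w where "w i = (B (Suc i) - B i) mod int n" for i
  define d where "d = card {i. i < n \<and> B (Suc i) < B i}"
  have w: "w i = B (Suc i) - B i + int n * of_bool (B (Suc i) < B i)" for i
  proof -
    have "w i = (B (Suc i) - B i + int n * of_bool (B (Suc i) < B i)) mod int n"
      by (simp add: w_def)
    also have "\<dots> = B (Suc i) - B i + int n * of_bool (B (Suc i) < B i)"
      using range[of i] range[of "Suc i"] by (intro mod_pos_pos_trivial) auto
    finally show ?thesis .
  qed
  have "sum w {..<n} = (\<Sum>i<n. B (Suc i) - B i) + int n * (\<Sum>i<n. of_bool (B (Suc i) < B i))"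
    by (simp add: w sum.distrib sum_distrib_left)
  also have "(\<Sum>i<n. B (Suc i) - B i) = 0"
    using per[of 0] by (simp add: sum_lessThan_telescope)
  also have "(\<Sum>i<n. of_bool (B (Suc i) < B i)) = int d"
    by (simp add: d_def of_bool_def sum.If_cases lessThan_def Int_def)
  finally have total: "sum w {..<n} = int n * int d" by simp
  \<comment> \<open>The first \<open>n * r\<close> differences are summed in two ways, as
    \<open>r\<close> periods of length \<open>n\<close> and as \<open>n\<close> periods of length
    \<open>r\<close>. Cancelling \<open>n\<close> gives the sum over \<open>r\<close> consecutive
    ones.\<close>
  have "w (i + n) = w i" for i using per[of i] per[of "Suc i"] by (simp add: w_def)
  then have 1: "sum w {..<r * n} = int r * sum w {..<n}" by (rule sum_periodic)
  have "w (i + r) = w i" for i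
    using cong_diff[OF shift[of "Suc i"] shift[of i]] by (simp add: w_def cong_def)
  then have "sum w {..<n * r} = int n * sum w {..<r}" by (rule sum_periodic)
  then have "int n * sum w {..<r} = int n * (int r * int d)"
    using 1 total by (simp add: mult.commute mult.left_commute)
  then have Gr: "sum w {..<r} = int r * int d" using n \<open>t > 0\<close> \<open>p > 1\<close> by simp
  have "[sum w {..<i} = B i - B 0] (mod int n)" for i
  proof (induction i)
    case (Suc i)
    have "[w i = B (Suc i) - B i] (mod int n)" by (simp add: w_def cong_def)
    from cong_add[OF Suc this] show ?case by simp
  qed auto
  from this[of r] have "[int r * int d + int t = B r - B 0 + int t] (mod int n)"
    by (simp add: Gr cong_add_rcancel)
  moreover have "[B r - B 0 + int t = 0] (mod int n)"
    using cong_diff[OF cong_sym[OF shift[of 0]] cong_refl[of "B 0"]] by (simp add: algebra_simps)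
  ultimately have "[int r * int d + int t = 0] (mod int n)"
    by (rule cong_trans)
  then have t: "int n dvd int r * int d + int t"
    by (simp add: cong_0_iff)
  \<comment> \<open>Iterating the symmetry \<open>p\<close> times translates by
    \<open>p * t = n\<close>, that is, not at all. Injectivity on a period then forces
    \<open>n\<close> to divide \<open>p * r\<close>, hence \<open>r * d\<close> because
    \<open>p\<close> divides \<open>d\<close>.\<close>
  have "[B 0 = B (j * r) + int (j * t)] (mod int n)" for j
  proof (induction j)
    case (Suc j)
    have "[B (j * r) + int (j * t) = B (j * r + r) + int t + int (j * t)] (mod int n)"
      by (rule cong_add[OF shift cong_refl])
    from cong_trans[OF Suc this] show ?case by (simp add: algebra_simps)
  qed simp
  from this[of p] have "[B 0 = B (p * r)] (mod int n)" by (simp add: n cong_def)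
  then have "B 0 = B (p * r)" using range cong_less_imp_eq_int by blast
  then have "n dvd p * r" using inj[of 0 "p * r"] by (simp add: mod_0_imp_dvd)
  moreover obtain d' where "d = p * d'" using des by (auto simp: d_def)
  ultimately have "n dvd r * d" by (metis dvd_mult2 mult.assoc mult.commute)
  then have "int n dvd int r * int d" by (metis of_nat_dvd_iff of_nat_mult)
  then have "n dvd t" using t by (simp add: dvd_add_right_iff)
  then show False using n \<open>t > 0\<close> \<open>p > 1\<close> by (auto dest: dvd_imp_le)
qed

subsection \<open>Ascents, inversions and parity-alternation of lists\<close>

lemma ascents_Cons_Cons:
  "ascents (x # y # zs) = (if x < y then {0} else {}) \<union> Suc ` ascents (y # zs)"
proof (intro set_eqI)
  fix i
  show "i \<in> ascents (x # y # zs) \<longleftrightarrow> i \<in> (if x < y then {0} else {}) \<union> Suc ` ascents (y # zs)"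
    by (cases i) (auto simp: ascents_def)
qed

lemma ascents_short [simp]: "ascents [] = {}" "ascents [x] = {}"
  by (auto simp: ascents_def)

lemma finite_ascents [simp]: "finite (ascents a)"
  by (rule finite_subset[of _ "{..<length a}"]) (auto simp: ascents_def)

lemma ascents_map_Suc [simp]: "ascents (map Suc a) = ascents a"
  by (auto simp: ascents_def)

lemma card_ascents_Cons_Cons:
  "card (ascents (x # y # zs)) = of_bool (x < y) + card (ascents (y # zs))"
proof -
  have "0 \<notin> Suc ` ascents (y # zs)" by auto
  then show ?thesis by (simp add: ascents_Cons_Cons card_image)
qed

lemma card_ascents_append:
  assumes "xs \<noteq> []" and "ys \<noteq> []"
  shows "card (ascents (xs @ ys)) =
    card (ascents xs) + card (ascents ys) + of_bool (last xs < hd ys)"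
  using assms(1)
proof (induction xs rule: induct_list012)
  case (2 x)
  then show ?case using assms(2) by (cases ys) (auto simp: card_ascents_Cons_Cons)
qed (auto simp: card_ascents_Cons_Cons)

lemma finite_inversions [simp]: "finite (inversions a)"
  by (rule finite_subset[of _ "{..<length a} \<times> {..<length a}"]) (auto simp: inversions_def)

lemma inversions_map_Suc [simp]: "inversions (map Suc a) = inversions a"
  by (auto simp: inversions_def)

lemma inversions_Cons:
  "inversions (x # xs) =
    (\<lambda>j. (0, Suc j)) ` {j. j < length xs \<and> xs ! j < x} \<union> map_prod Suc Suc ` inversions xs"
proof (intro set_eqI)
  fix z :: "nat \<times> nat"
  obtain i j where "z = (i, j)" by fastforce
  then show "z \<in> inversions (x # xs) \<longleftrightarrow> z \<in> (\<lambda>j. (0, Suc j)) ` {j. j < length xs \<and> xs ! j < x}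
      \<union> map_prod Suc Suc ` inversions xs"
    by (cases i; cases j) (auto simp: inversions_def)
qed

lemma card_inversions_Cons:
  "card (inversions (x # xs)) = length (filter (\<lambda>y. y < x) xs) + card (inversions xs)"
proof -
  have "card (inversions (x # xs)) =
      card ((\<lambda>j. (0 :: nat, Suc j)) ` {j. j < length xs \<and> xs ! j < x}) +
      card (map_prod Suc Suc ` inversions xs)"
    unfolding inversions_Cons by (rule card_Un_disjoint) auto
  also have "card ((\<lambda>j. (0 :: nat, Suc j)) ` {j. j < length xs \<and> xs ! j < x}) =
      length (filter (\<lambda>y. y < x) xs)"
    by (subst card_image) (auto simp: inj_on_def length_filter_conv_card)
  also have "card (map_prod Suc Suc ` inversions xs) = card (inversions xs)"
    by (rule card_image) (auto simp: inj_on_def)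
  finally show ?thesis .
qed

definition cross_inversions :: "nat list \<Rightarrow> nat list \<Rightarrow> nat" where
  "cross_inversions xs ys = (\<Sum>x\<leftarrow>xs. length (filter (\<lambda>y. y < x) ys))"

lemma card_inversions_append:
  "card (inversions (xs @ ys)) =
    card (inversions xs) + card (inversions ys) + cross_inversions xs ys"
proof (induction xs)
  case Nil
  then show ?case by (simp add: cross_inversions_def inversions_def)
qed (simp add: card_inversions_Cons cross_inversions_def)

lemma cross_inversions_Cons_right:
  "cross_inversions xs (y # ys) = length (filter (\<lambda>x. y < x) xs) + cross_inversions xs ys"
  by (induction xs) (auto simp: cross_inversions_def)

lemma cross_inversions_map_Suc [simp]:
  "cross_inversions (map Suc xs) (map Suc ys) = cross_inversions xs ys"
  by (simp add: cross_inversions_def filter_map comp_def)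

text \<open>Each pair with one entry from either list is inverted in exactly one of the two orders.
  Thus exchanging two blocks whose lengths have an even product preserves the parity of the
  inversion number.\<close>

lemma cross_inversions_swap:
  assumes "set xs \<inter> set ys = {}"
  shows "cross_inversions xs ys + cross_inversions ys xs = length xs * length ys"
  using assms
proof (induction xs)
  case Nil
  then show ?case by (induction ys) (auto simp: cross_inversions_def)
next
  case (Cons x xs)
  have "filter (\<lambda>y. x < y) ys = filter (\<lambda>y. \<not> y < x) ys"
    using Cons.prems by (intro filter_cong) auto
  then have "length (filter (\<lambda>y. y < x) ys) + length (filter (\<lambda>y. x < y) ys) = length ys"
    by (simp add: sum_length_filter_compl)
  then show ?case using Cons
    by (simp add: cross_inversions_Cons_right) (simp add: cross_inversions_def)
qed

text \<open>"Even" refers to the list index, not to the value: these are the values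
  \<open>a_1\<close>, \<open>a_3\<close>, and so on. Describing positions through a set of values
  makes alternation a condition on \<open>v\<close> and \<open>Suc v\<close>.\<close>

definition even_entries :: "nat list \<Rightarrow> nat set" where
  "even_entries a = (!) a ` {i. i < length a \<and> even i}"

lemma nth_in_even_entries_iff:
  assumes "distinct a" and "i < length a"
  shows "a ! i \<in> even_entries a \<longleftrightarrow> even i"
  using assms by (auto simp: even_entries_def nth_eq_iff_index_eq)

text \<open>Pigeonhole: for \<open>N = 2 * h + 1\<close> there are \<open>h + 1\<close> even indices
  but only \<open>h\<close> even values.\<close>

lemma exists_odd_entry_at_even_position:
  assumes a: "a \<in> permutations_of_set {1..N}" and "odd N"
  shows "\<exists>i<N. even i \<and> odd (a ! i)"
proof (rule ccontr)
  assume *: "\<not> ?thesis"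
  obtain h where N: "N = 2 * h + 1" using \<open>odd N\<close> by (auto elim: oddE)
  have len: "length a = N" and set: "set a = {1..N}" and dist: "distinct a"
    using a by (auto simp: length_finite_permutations_of_set dest: permutations_of_setD)
  have "{i. i < length a \<and> even i} = (\<lambda>j. 2 * j) ` {..h}"
    by (auto simp: len N elim!: evenE)
  then have "card {i. i < length a \<and> even i} = h + 1"
    by (simp add: card_image inj_on_def)
  moreover have "inj_on ((!) a) {i. i < length a \<and> even i}"
    using dist by (auto simp: inj_on_def nth_eq_iff_index_eq)
  ultimately have "card (even_entries a) = h + 1"
    by (simp add: even_entries_def card_image)
  moreover have "even_entries a \<subseteq> (\<lambda>j. 2 * j) ` {1..h}"
  proof
    fix x assume "x \<in> even_entries a"
    then obtain i where i: "i < N" "even i" "x = a ! i" by (auto simp: even_entries_def len)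
    then have "even x" using * by auto
    moreover have "x \<in> {1..N}" using i set len nth_mem by metis
    ultimately show "x \<in> (\<lambda>j. 2 * j) ` {1..h}" by (auto simp: N elim!: evenE)
  qed
  then have "card (even_entries a) \<le> h"
    using surj_card_le[of "{1..h}"] by fastforce
  ultimately show False by simp
qed

text \<open>The first entry decides all parities along an alternating list, and counting excludes an
  even first entry.\<close>

lemma parity_alternate_iff:
  assumes a: "a \<in> permutations_of_set {1..N}" and "odd N"
  shows "parity_alternate a \<longleftrightarrow> (\<forall>i<N. even (a ! i) \<longleftrightarrow> odd i)"
proof
  have len: "length a = N" using a by (simp add: length_finite_permutations_of_set)
  show "parity_alternate a" if "\<forall>i<N. even (a ! i) \<longleftrightarrow> odd i"
    using that by (auto simp: parity_alternate_def len)
  assume alt: "parity_alternate a"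
  have *: "even (a ! i) \<longleftrightarrow> (even (a ! 0) \<longleftrightarrow> even i)" if "i < N" for i
    using that
  proof (induction i)
    case (Suc i)
    then have "even (a ! i) \<longleftrightarrow> odd (a ! Suc i)" using alt by (simp add: parity_alternate_def len)
    then show ?case using Suc by auto
  qed simp
  then have "odd (a ! 0)" using exists_odd_entry_at_even_position[OF assms] by auto
  then show "\<forall>i<N. even (a ! i) \<longleftrightarrow> odd i" using * by auto
qed

text \<open>This is alternation read along the values instead of the positions. The right-hand side
  fixes the index parity of every value up to one global flip, which counting excludes. A violating
  \<open>v\<close> is what the sign-reversing involution exchanges with its successor.\<close>

lemma parity_alternate_iff_even_entries:
  assumes a: "a \<in> permutations_of_set {1..N}" and "odd N"
  shows "parity_alternate a \<longleftrightarrow> (\<forall>v\<in>{1..<N}. v \<in> even_entries a \<longleftrightarrow> Suc v \<notin> even_entries a)"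
proof
  have len: "length a = N" and set: "set a = {1..N}" and dist: "distinct a"
    using a by (auto simp: length_finite_permutations_of_set dest: permutations_of_setD)
  show "\<forall>v\<in>{1..<N}. v \<in> even_entries a \<longleftrightarrow> Suc v \<notin> even_entries a" if "parity_alternate a"
  proof -
    have "v \<in> even_entries a \<longleftrightarrow> odd v" if "v \<in> {1..N}" for v
    proof -
      obtain i where "i < N" "v = a ! i" using \<open>v \<in> {1..N}\<close> set len by (metis in_set_conv_nth)
      then show ?thesis
        using \<open>parity_alternate a\<close> parity_alternate_iff[OF assms] nth_in_even_entries_iff[OF dist]
        by (auto simp: len)
    qed
    then show ?thesis by auto
  qed
  assume alt: "\<forall>v\<in>{1..<N}. v \<in> even_entries a \<longleftrightarrow> Suc v \<notin> even_entries a"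
  have *: "v \<in> even_entries a \<longleftrightarrow> (1 \<in> even_entries a \<longleftrightarrow> odd v)" if "1 \<le> v" "v \<le> N" for v
    using that
  proof (induction v rule: dec_induct)
    case (step v)
    then have "v \<in> even_entries a \<longleftrightarrow> Suc v \<notin> even_entries a" using alt by simp
    then show ?case using step by auto
  qed simp
  have **: "even i \<longleftrightarrow> (1 \<in> even_entries a \<longleftrightarrow> odd (a ! i))" if "i < N" for i
  proof -
    have "a ! i \<in> {1..N}" using that set len nth_mem by metis
    then show ?thesis
      using *[of "a ! i"] nth_in_even_entries_iff[OF dist, of i] that by (simp add: len)
  qed
  then have "1 \<in> even_entries a" using exists_odd_entry_at_even_position[OF assms] by auto
  then show "parity_alternate a" using ** parity_alternate_iff[OF assms] by auto
qed

subsection \<open>The cyclic shift of the values\<close>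

text \<open>
  Adding \<open>1\<close> modulo \<open>N + 1\<close> turns \<open>0, xs, N, ys\<close> into \<open>1, xs + 1, 0, ys + 1\<close>, which is rotated
  so that \<open>0\<close> comes first and is dropped again.
\<close>

definition shift_up :: "nat \<Rightarrow> nat list \<Rightarrow> nat list" where
  "shift_up N a =
    map Suc (tl (dropWhile (\<lambda>x. x \<noteq> N) a)) @ 1 # map Suc (takeWhile (\<lambda>x. x \<noteq> N) a)"

lemma shift_up_eq:
  assumes "N \<notin> set xs"
  shows "shift_up N (xs @ N # ys) = map Suc ys @ 1 # map Suc xs"
proof -
  have "\<And>x. x \<in> set xs \<Longrightarrow> x \<noteq> N" using assms by auto
  then show ?thesis
    by (simp add: shift_up_def takeWhile_append2 dropWhile_append2)
qed

lemma permutation_split_at_max: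
  fixes N :: nat
  assumes "a \<in> permutations_of_set {1..N}" and "N > 0"
  obtains xs ys where "a = xs @ N # ys" and "set xs \<union> set ys = {1..<N}"
    and "set xs \<inter> set ys = {}" and "distinct xs" and "distinct ys"
proof -
  have set: "set a = {1..N}" and dist: "distinct a"
    using assms(1) by (auto dest: permutations_of_setD)
  then have "N \<in> set a" using \<open>N > 0\<close> by (simp add: Suc_le_eq)
  then obtain xs ys where a: "a = xs @ N # ys" by (meson split_list)
  have "N \<notin> set xs \<union> set ys" using dist a by auto
  then have "set xs \<union> set ys = set a - {N}" using a by auto
  also have "\<dots> = {1..<N}" unfolding set by auto
  finally have "set xs \<union> set ys = {1..<N}" .
  then show thesis using dist unfolding a by (intro that[OF a]) simp_all
qed

lemma shift_up_in_permutations: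
  assumes "a \<in> permutations_of_set {1..N}" and "N > 0"
  shows "shift_up N a \<in> permutations_of_set {1..N}"
proof -
  obtain xs ys where a: "a = xs @ N # ys" and un: "set xs \<union> set ys = {1..<N}"
    and int: "set xs \<inter> set ys = {}" and dist: "distinct xs" "distinct ys"
    using permutation_split_at_max[OF assms] .
  have "N \<notin> set xs" using un by auto
  then have eq: "shift_up N a = map Suc ys @ 1 # map Suc xs" by (simp add: a shift_up_eq)
  have "set (shift_up N a) = insert 1 (Suc ` (set xs \<union> set ys))" by (auto simp: eq)
  also have "\<dots> = {1..N}" using \<open>N > 0\<close> unfolding un by (auto simp: image_Suc_atLeastLessThan)
  finally have "set (shift_up N a) = {1..N}" .
  moreover have "0 \<notin> set xs \<union> set ys" by (simp add: un)
  then have "distinct (shift_up N a)" using dist int by (auto simp: eq distinct_map)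
  ultimately show ?thesis by blast
qed

text \<open>Ascents inside the two blocks survive. The only other ascent is the one from
  \<open>xs\<close> up to \<open>N\<close>, replaced by the one from \<open>1\<close> up to the
  shifted \<open>xs\<close>; both exist exactly when \<open>xs\<close> is nonempty.\<close>

lemma card_ascents_shift_up:
  assumes "a \<in> permutations_of_set {1..N}" and "N > 0"
  shows "card (ascents (shift_up N a)) = card (ascents a)"
proof -
  obtain xs ys where a: "a = xs @ N # ys" and un: "set xs \<union> set ys = {1..<N}"
    using permutation_split_at_max[OF assms] by metis
  have "N \<notin> set xs" using un by auto
  then have eq: "shift_up N a = map Suc ys @ 1 # map Suc xs" by (simp add: a shift_up_eq)
  have below: "x < N" if "x \<in> set xs \<union> set ys" for x using that un by auto
  have pos: "x > 0" if "x \<in> set xs \<union> set ys" for x using that un by auto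
  have "card (ascents (N # ys)) = card (ascents ys)"
    using below[of "hd ys"] by (cases ys) (auto simp: card_ascents_Cons_Cons)
  then have 1: "card (ascents a) = card (ascents xs) + card (ascents ys) + of_bool (xs \<noteq> [])"
    using below by (cases "xs = []") (auto simp: a card_ascents_append)
  have "card (ascents (1 # map Suc xs)) = card (ascents xs) + of_bool (xs \<noteq> [])"
  proof (cases xs)
    case (Cons x zs)
    then have "x > 0" using pos by auto
    then show ?thesis
      using ascents_map_Suc[of xs] by (simp add: Cons card_ascents_Cons_Cons)
  qed simp
  then have 2: "card (ascents (shift_up N a)) =
      card (ascents xs) + card (ascents ys) + of_bool (xs \<noteq> [])"
    by (cases "ys = []") (auto simp: eq card_ascents_append last_map)
  show ?thesis by (simp only: 1 2)
qed

text \<open>Alternation puts the odd value \<open>N\<close> at an even index, so both blocks around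
  it have even length. Exchanging them changes the inversion number by an even amount, while
  \<open>N\<close> before \<open>ys\<close> and \<open>1\<close> after the shifted \<open>ys\<close>
  each contribute \<open>length ys\<close> inversions.\<close>

lemma shift_up_parity:
  assumes a: "a \<in> permutations_of_set {1..N}" and "odd N" and alt: "parity_alternate a"
  shows "parity_alternate (shift_up N a)"
    and "even (card (inversions (shift_up N a))) \<longleftrightarrow> even (card (inversions a))"
proof -
  have "N > 0" using \<open>odd N\<close> by (cases N) auto
  obtain xs ys where split: "a = xs @ N # ys" and un: "set xs \<union> set ys = {1..<N}"
    and disj: "set xs \<inter> set ys = {}"
    using permutation_split_at_max[OF a \<open>N > 0\<close>] by metis
  have "N \<notin> set xs" using un by auto
  then have eq: "shift_up N a = map Suc ys @ 1 # map Suc xs" by (simp add: split shift_up_eq)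
  have "length a = N" using a by (simp add: length_finite_permutations_of_set)
  then have len: "Suc (length xs + length ys) = N" by (simp add: split)
  have par: "even (a ! i) \<longleftrightarrow> odd i" if "i < N" for i
    using parity_alternate_iff[OF a \<open>odd N\<close>] alt that by blast
  have even_xs: "even (length xs)"
    using par[of "length xs"] len \<open>odd N\<close> by (simp add: split)
  then have even_ys: "even (length ys)" using len \<open>odd N\<close> by auto
  \<comment> \<open>Every entry of \<open>xs\<close> and \<open>ys\<close> moves by an odd number of
    places while its value grows by one, so both parities flip together.\<close>
  have "even (shift_up N a ! i) \<longleftrightarrow> odd i" if "i < N" for i
  proof -
    consider "i < length ys" | "i = length ys" | "length ys < i" by linarith
    then show ?thesis
    proof cases
      case 1
      then have "a ! (length xs + Suc i) = ys ! i" by (simp add: split nth_append)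
      then show ?thesis using 1 par[of "length xs + Suc i"] len even_xs
        by (simp add: eq nth_append)
    next
      case 2
      then show ?thesis using even_ys by (simp add: eq nth_append)
    next
      case 3
      then obtain j where j: "i = length ys + Suc j" by (metis add_Suc_right less_imp_Suc_add)
      then have "j < length xs" using that len by simp
      then have "a ! j = xs ! j" by (simp add: split nth_append)
      then show ?thesis using j \<open>j < length xs\<close> par[of j] len even_ys by (simp add: eq nth_append)
    qed
  qed
  then show "parity_alternate (shift_up N a)"
    using parity_alternate_iff[OF shift_up_in_permutations[OF a \<open>N > 0\<close>] \<open>odd N\<close>] by blast
  have bounds: "1 \<le> x \<and> x < N" if "x \<in> set xs \<union> set ys" for x
    using that unfolding un by simp
  have "filter (\<lambda>y. y < N) ys = ys" using bounds by (intro filter_True) auto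
  moreover have "filter (\<lambda>y. N < y) xs = []" using bounds by (intro filter_False) force
  ultimately have 1: "card (inversions a) =
      card (inversions xs) + card (inversions ys) + cross_inversions xs ys + length ys"
    by (simp add: split card_inversions_append card_inversions_Cons cross_inversions_Cons_right)
  have "filter (\<lambda>x. 1 < x) (map Suc ys) = map Suc ys"
    using bounds by (intro filter_True) (auto simp: Suc_le_eq)
  then have 2: "card (inversions (shift_up N a)) =
      card (inversions xs) + card (inversions ys) + cross_inversions ys xs + length ys"
    by (simp add: eq card_inversions_append card_inversions_Cons cross_inversions_Cons_right
        filter_map comp_def)
  have "even (cross_inversions xs ys + cross_inversions ys xs)"
    using cross_inversions_swap[OF disj] even_xs by simp
  then show "even (card (inversions (shift_up N a))) \<longleftrightarrow> even (card (inversions a))"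
    unfolding 1 2 by auto
qed

text \<open>The leading \<open>0\<close> restores the missing residue. In this form the shift is a
  translation up to rotation, which is easy to iterate.\<close>

lemma Cons_0_shift_up:
  assumes "a \<in> permutations_of_set {1..N}" and "N > 0"
  shows "\<exists>r. 0 # shift_up N a = rotate r (map (\<lambda>x. Suc x mod Suc N) (0 # a))"
proof -
  obtain xs ys where a: "a = xs @ N # ys" and un: "set xs \<union> set ys = {1..<N}"
    using permutation_split_at_max[OF assms] by metis
  have "N \<notin> set xs" using un by auto
  then have eq: "shift_up N a = map Suc ys @ 1 # map Suc xs" by (simp add: a shift_up_eq)
  have "map (\<lambda>x. Suc x mod Suc N) zs = map Suc zs" if "set zs \<subseteq> {1..<N}" for zs
    using that by (intro map_cong) auto
  then have "map (\<lambda>x. Suc x mod Suc N) (0 # a) = (1 # map Suc xs) @ (0 # map Suc ys)"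
    using un \<open>N > 0\<close> by (auto simp: a)
  then have "rotate (length (1 # map Suc xs)) (map (\<lambda>x. Suc x mod Suc N) (0 # a)) =
      0 # shift_up N a"
    by (simp only: rotate_append) (simp add: eq)
  then show ?thesis by metis
qed

section \<open>Iterates of the cyclic shift: period and absence of fixed points\<close>

lemma shift_up_funpow_in_permutations:
  assumes "a \<in> permutations_of_set {1..N}" and "N > 0"
  shows "(shift_up N ^^ t) a \<in> permutations_of_set {1..N}"
  by (induction t) (use assms shift_up_in_permutations in auto)

text \<open>Rotations commute with entrywise maps, so the rotations and the translations accumulate
  separately.\<close>

lemma Cons_0_shift_up_funpow:
  assumes "a \<in> permutations_of_set {1..N}" and "N > 0"
  shows "\<exists>r. 0 # (shift_up N ^^ t) a = rotate r (map (\<lambda>x. (x + t) mod Suc N) (0 # a))"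
proof (induction t)
  case 0
  have "map (\<lambda>x. (x + 0) mod Suc N) (0 # a) = 0 # a"
    using permutations_of_setD(1)[OF assms(1)] by (intro map_idI) auto
  then show ?case by (intro exI[of _ 0]) simp
next
  case (Suc t)
  then obtain r where r: "0 # (shift_up N ^^ t) a =
      rotate r (map (\<lambda>x. (x + t) mod Suc N) (0 # a))" ..
  obtain r' where "0 # shift_up N ((shift_up N ^^ t) a) =
      rotate r' (map (\<lambda>x. Suc x mod Suc N) (0 # (shift_up N ^^ t) a))"
    using Cons_0_shift_up[OF shift_up_funpow_in_permutations[OF assms] \<open>N > 0\<close>] by blast
  then have "0 # (shift_up N ^^ Suc t) a =
      rotate (r' + r) (map (\<lambda>x. (x + Suc t) mod Suc N) (0 # a))"
    by (simp only: r rotate_map[symmetric] rotate_rotate map_map comp_def mod_Suc_eq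
        funpow.simps add_Suc_right)
  then show ?case by blast
qed

text \<open>Translation by \<open>Suc N\<close> is trivial, so only a rotation of
  \<open>0 # a\<close> remains. As it again starts with the unique \<open>0\<close>, that rotation
  is trivial too.\<close>

lemma shift_up_funpow_period:
  assumes a: "a \<in> permutations_of_set {1..N}" and "N > 0"
  shows "(shift_up N ^^ Suc N) a = a"
proof -
  obtain r where r: "0 # (shift_up N ^^ Suc N) a =
      rotate r (map (\<lambda>x. (x + Suc N) mod Suc N) (0 # a))"
    using Cons_0_shift_up_funpow[OF assms] by blast
  have set: "set a = {1..N}" and dist: "distinct (0 # a)" and len: "length a = N"
    using a by (auto simp: length_finite_permutations_of_set dest: permutations_of_setD)
  have "(x + Suc N) mod Suc N = x" if "x \<le> N" for x
    using that by (simp only: mod_add_self2 mod_less less_Suc_eq_le)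
  then have "map (\<lambda>x. (x + Suc N) mod Suc N) (0 # a) = 0 # a"
    using set by (intro map_idI) (auto simp del: add_Suc_right)
  with r have r: "0 # (shift_up N ^^ Suc N) a = rotate r (0 # a)" by (simp only:)
  then have "(0 # a) ! 0 = (0 # a) ! (r mod length (0 # a))"
    using nth_rotate[of 0 "0 # a" r] by (metis add_0_right length_greater_0_conv list.distinct(1) nth_Cons_0)
  then have "r mod length (0 # a) = 0"
    using nth_eq_iff_index_eq[OF dist, of 0 "r mod length (0 # a)"] by simp
  then have "rotate r (0 # a) = 0 # a" by (simp only: rotate_id)
  with r show ?thesis by simp
qed

lemma shift_up_funpow_fixed_point_free:
  assumes a: "a \<in> permutations_of_set {1..N}" and "N > 0"
    and N: "Suc N = p * t" and "p > 1" and asc: "p dvd Suc (card (ascents a))"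
  shows "(shift_up N ^^ t) a \<noteq> a"
proof
  assume fixed: "(shift_up N ^^ t) a = a"
  define b where "b = 0 # a"
  obtain r where r: "b = rotate r (map (\<lambda>x. (x + t) mod Suc N) b)"
    using Cons_0_shift_up_funpow[OF assms(1,2), of t] unfolding fixed b_def by blast
  have dist: "distinct b" and set: "set b = {0..N}" and len: "length b = Suc N"
    using a by (auto simp: b_def length_finite_permutations_of_set dest: permutations_of_setD)
  have asc_len: "Suc i < N" if "i \<in> ascents a" for i
    using that len by (auto simp: ascents_def b_def)
  define B where "B i = int (b ! (i mod Suc N))" for i
  have upper: "b ! (i mod Suc N) < Suc N" for i
    using set len nth_mem[of "i mod Suc N" b] by simp
  show False
  proof (rule no_translation_symmetry[of B "Suc N" r t p])
    show "i mod Suc N = j mod Suc N" if "B i = B j" for i j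
      using that dist by (simp add: B_def nth_eq_iff_index_eq len)
    show "[B i = B (i + r) + int t] (mod int (Suc N))" for i
    proof -
      have "b ! (i mod Suc N) = map (\<lambda>x. (x + t) mod Suc N) b ! ((r + i mod Suc N) mod Suc N)"
        by (subst r, subst nth_rotate) (simp_all add: len)
      also have "\<dots> = (b ! ((r + i mod Suc N) mod Suc N) + t) mod Suc N"
        by (subst nth_map) (simp_all add: len)
      also have "(r + i mod Suc N) mod Suc N = (i + r) mod Suc N"
        by (simp add: mod_add_right_eq add.commute)
      finally show ?thesis
        by (simp add: B_def cong_def zmod_int del: of_nat_Suc)
    qed
    \<comment> \<open>Reading \<open>0 # a\<close> cyclically, index \<open>0\<close> is always an
      ascent and index \<open>N\<close>, the return to \<open>0\<close>, always a descent. The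
      cyclic ascents therefore number one more than the ascents of \<open>a\<close>.\<close>
    have "{i. i < Suc N \<and> B (Suc i) < B i} = {..<Suc N} - insert 0 (Suc ` ascents a)"
    proof (intro set_eqI)
      fix i
      have neq: "a ! (i - 1) \<noteq> a ! i" if "0 < i" "i < N"
        using that dist len by (auto simp: b_def nth_eq_iff_index_eq)
      have pos: "a ! 0 > 0" "a ! (N - 1) > 0"
        using permutations_of_setD(1)[OF a] len \<open>N > 0\<close> nth_mem[of _ a] by (auto simp: b_def Suc_le_eq)
      consider "i = 0" | "0 < i" "i < N" | "i = N" | "i > N" by linarith
      then show "i \<in> {i. i < Suc N \<and> B (Suc i) < B i} \<longleftrightarrow>
          i \<in> {..<Suc N} - insert 0 (Suc ` ascents a)"
      proof cases
        case 1
        then show ?thesis using pos \<open>N > 0\<close> by (simp add: B_def b_def)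
      next
        case 2
        then obtain j where j: "i = Suc j" by (cases i) auto
        with 2 neq have "a ! j \<noteq> a ! Suc j" by simp
        then show ?thesis using 2 len
          by (auto simp: j B_def b_def ascents_def)
      next
        case 3
        then obtain j where j: "i = Suc j" using \<open>N > 0\<close> by (cases i) auto
        then show ?thesis using 3 pos asc_len
          by (auto simp: B_def b_def)
      next
        case 4
        then show ?thesis by auto
      qed
    qed
    moreover have "insert 0 (Suc ` ascents a) \<subseteq> {..<Suc N}" using asc_len by fastforce
    moreover have "card (insert 0 (Suc ` ascents a)) = Suc (card (ascents a))"
      by (simp add: card_image)
    ultimately have "card {i. i < Suc N \<and> B (Suc i) < B i} = Suc N - Suc (card (ascents a))"
      by (simp add: card_Diff_subset)
    moreover have "p dvd Suc N - Suc (card (ascents a))"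
      using asc N by (intro dvd_diff_nat) auto
    ultimately show "p dvd card {i. i < Suc N \<and> B (Suc i) < B i}" by simp
    show "B i < int (Suc N)" for i unfolding B_def of_nat_less_iff by (rule upper)
    show "t > 0" using N by (cases t) auto
  qed (use N \<open>p > 1\<close> in \<open>simp_all add: B_def\<close>)
qed

subsection \<open>The sign-reversing involution\<close>

abbreviation swap_adjacent :: "nat \<Rightarrow> nat list \<Rightarrow> nat list" where
  "swap_adjacent v \<equiv> map (transpose v (Suc v))"

text \<open>No value lies strictly between \<open>v\<close> and \<open>Suc v\<close>, so exchanging
  them affects only their mutual comparison.\<close>

lemma transpose_Suc_less_iff:
  assumes "x \<noteq> y" and "{x, y} \<noteq> {v, Suc v}"
  shows "transpose v (Suc v) x < transpose v (Suc v) y \<longleftrightarrow> x < y"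
  using assms by (auto simp: transpose_def)

lemma swap_adjacent_in_permutations:
  assumes "a \<in> permutations_of_set {1..N}" and "v \<in> {1..<N}"
  shows "swap_adjacent v a \<in> permutations_of_set {1..N}"
proof (rule permutations_of_setI)
  have "transpose v (Suc v) ` {1..N} = {1..N}"
    using assms(2) by (intro transpose_image_eq) auto
  then show "set (swap_adjacent v a) = {1..N}"
    using permutations_of_setD(1)[OF assms(1)] by simp
  show "distinct (swap_adjacent v a)"
    using permutations_of_setD(2)[OF assms(1)] by (simp add: distinct_map)
qed

lemma even_entries_swap_adjacent:
  assumes "v \<in> even_entries a \<longleftrightarrow> Suc v \<in> even_entries a"
  shows "even_entries (swap_adjacent v a) = even_entries a"
proof -
  have "even_entries (swap_adjacent v a) = transpose v (Suc v) ` even_entries a"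
    by (auto simp: even_entries_def image_iff)
  also have "\<dots> = even_entries a" using assms by (rule transpose_image_eq)
  finally show ?thesis .
qed

text \<open>Neighbouring entries have indices of opposite parity, so \<open>v\<close> and
  \<open>Suc v\<close> are never neighbours and no comparison of neighbours changes.\<close>

lemma ascents_swap_adjacent:
  assumes "distinct a" and "v \<in> even_entries a \<longleftrightarrow> Suc v \<in> even_entries a"
  shows "ascents (swap_adjacent v a) = ascents a"
proof -
  have "transpose v (Suc v) (a ! i) < transpose v (Suc v) (a ! Suc i) \<longleftrightarrow> a ! i < a ! Suc i"
    if "Suc i < length a" for i
  proof (rule transpose_Suc_less_iff)
    show "a ! i \<noteq> a ! Suc i" using that assms(1) by (simp add: nth_eq_iff_index_eq)
    have "a ! i \<in> even_entries a \<longleftrightarrow> a ! Suc i \<notin> even_entries a"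
      using that nth_in_even_entries_iff[OF assms(1)] by simp
    then show "{a ! i, a ! Suc i} \<noteq> {v, Suc v}"
      using assms(2) by (auto simp: doubleton_eq_iff)
  qed
  then show ?thesis by (auto simp: ascents_def)
qed

lemma parity_card_differ_in_one:
  assumes "finite A" and "finite B" and "\<And>z. z \<noteq> q \<Longrightarrow> z \<in> A \<longleftrightarrow> z \<in> B"
    and "q \<in> A \<longleftrightarrow> q \<notin> B"
  shows "even (card A) \<longleftrightarrow> odd (card B)"
proof (cases "q \<in> A")
  case True
  then have "q \<notin> B" using assms(4) by simp
  have "z \<in> A \<longleftrightarrow> z \<in> insert q B" for z using True assms(3)[of z] by auto
  then have "A = insert q B" by blast
  then show ?thesis using assms(1,2) \<open>q \<notin> B\<close> by simp
next
  case False
  have "z \<in> B \<longleftrightarrow> z \<in> insert q A" for z using False assms(3)[of z] assms(4) by auto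
  then have "B = insert q A" by blast
  then show ?thesis using assms(1,2) False by simp
qed

text \<open>Only the pair of indices holding \<open>v\<close> and \<open>Suc v\<close> changes its
  status as an inversion.\<close>

lemma parity_inversions_swap_adjacent:
  assumes "distinct a" and "v \<in> set a" and "Suc v \<in> set a"
  shows "even (card (inversions (swap_adjacent v a))) \<longleftrightarrow> odd (card (inversions a))"
proof -
  obtain i j where i: "i < length a" "a ! i = v" and j: "j < length a" "a ! j = Suc v"
    using assms by (metis in_set_conv_nth)
  then have "i \<noteq> j" by auto
  show ?thesis
  proof (rule parity_card_differ_in_one[of _ _ "(min i j, max i j)"])
    show "(min i j, max i j) \<in> inversions (swap_adjacent v a) \<longleftrightarrow>
        (min i j, max i j) \<notin> inversions a"
      using i j \<open>i \<noteq> j\<close> by (auto simp: inversions_def min_def max_def transpose_def)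
    fix z assume z: "z \<noteq> (min i j, max i j)"
    obtain k l where kl: "z = (k, l)" by fastforce
    have "transpose v (Suc v) (a ! l) < transpose v (Suc v) (a ! k) \<longleftrightarrow> a ! l < a ! k"
      if "k < l" "l < length a"
    proof (rule transpose_Suc_less_iff)
      show "a ! l \<noteq> a ! k" using that assms(1) by (simp add: nth_eq_iff_index_eq)
      show "{a ! l, a ! k} \<noteq> {v, Suc v}"
      proof
        assume "{a ! l, a ! k} = {v, Suc v}"
        then have "{a ! l, a ! k} = {a ! i, a ! j}" using i j by simp
        then have "a ! l = a ! i \<and> a ! k = a ! j \<or> a ! l = a ! j \<and> a ! k = a ! i"
          by (simp only: doubleton_eq_iff)
        then have "l = i \<and> k = j \<or> l = j \<and> k = i"
          using that i(1) j(1) nth_eq_iff_index_eq[OF assms(1)] by simp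
        then show False using z kl that by auto
      qed
    qed
    then show "z \<in> inversions (swap_adjacent v a) \<longleftrightarrow> z \<in> inversions a"
      by (auto simp: inversions_def kl)
  qed auto
qed

definition parity_swap :: "nat \<Rightarrow> nat list \<Rightarrow> nat list" where
  "parity_swap N a =
    swap_adjacent (LEAST v. v \<in> {1..<N} \<and> (v \<in> even_entries a \<longleftrightarrow> Suc v \<in> even_entries a)) a"

lemma parity_swap_sign_reversing_involution:
  assumes a: "a \<in> perms_with_ascents N j" and "\<not> parity_alternate a" and "odd N"
  shows "parity_swap N a \<in> perms_with_ascents N j"
    and "\<not> parity_alternate (parity_swap N a)"
    and "even (card (inversions (parity_swap N a))) \<longleftrightarrow> odd (card (inversions a))"
    and "parity_swap N (parity_swap N a) = a"
proof -
  have perm: "a \<in> permutations_of_set {1..N}" and asc: "int (card (ascents a)) = j"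
    using a by (auto simp: perms_with_ascents_def)
  define P where "P a v \<longleftrightarrow> v \<in> {1..<N} \<and> (v \<in> even_entries a \<longleftrightarrow> Suc v \<in> even_entries a)" for a v
  define v where "v = (LEAST v. P a v)"
  have swap_def: "parity_swap N x = swap_adjacent (LEAST v. P x v) x" for x
    by (simp add: parity_swap_def P_def)
  have "\<exists>v. P a v"
    using parity_alternate_iff_even_entries[OF perm \<open>odd N\<close>] assms(2) by (auto simp: P_def)
  then have "P a v" unfolding v_def by (rule LeastI_ex)
  then have v: "v \<in> {1..<N}" and v_iff: "v \<in> even_entries a \<longleftrightarrow> Suc v \<in> even_entries a"
    by (auto simp: P_def)
  have eq: "parity_swap N a = swap_adjacent v a" by (simp add: swap_def v_def)
  have ev: "even_entries (parity_swap N a) = even_entries a"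
    unfolding eq using v_iff by (rule even_entries_swap_adjacent)
  have set: "set a = {1..N}" and dist: "distinct a" using perm by (auto dest: permutations_of_setD)
  have perm': "parity_swap N a \<in> permutations_of_set {1..N}"
    unfolding eq using perm v by (rule swap_adjacent_in_permutations)
  then show "parity_swap N a \<in> perms_with_ascents N j"
    using asc ascents_swap_adjacent[OF dist v_iff] by (simp add: perms_with_ascents_def eq)
  show "\<not> parity_alternate (parity_swap N a)"
    using assms(2) parity_alternate_iff_even_entries[OF perm \<open>odd N\<close>]
      parity_alternate_iff_even_entries[OF perm' \<open>odd N\<close>] by (simp add: ev)
  show "even (card (inversions (parity_swap N a))) \<longleftrightarrow> odd (card (inversions a))"
    unfolding eq using v set by (intro parity_inversions_swap_adjacent[OF dist]) auto
  \<comment> \<open>The choice of \<open>v\<close> depends on the list only through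
    \<open>even_entries\<close>, which the swap preserves, so the second application picks the same
    \<open>v\<close>.\<close>
  have "(LEAST v. P (parity_swap N a) v) = v" by (simp add: P_def v_def ev)
  then have "parity_swap N (parity_swap N a) = swap_adjacent v (parity_swap N a)"
    by (simp only: swap_def[of "parity_swap N a"])
  then show "parity_swap N (parity_swap N a) = a" by (simp add: eq comp_def)
qed

lemma finite_perms_with_ascents [simp]: "finite (perms_with_ascents N j)"
  by (simp add: perms_with_ascents_def)

text \<open>The involution matches even with odd permutations outside the parity-alternate ones, so
  these cancel in the signed count.\<close>

lemma D_diff_eq_R_diff:
  assumes "odd N"
  shows "D_diff N j = R_diff N j"
proof -
  define E where "E = {a \<in> perms_with_ascents N j. \<not> parity_alternate a \<and> even (card (inversions a))}"
  define O' where "O' = {a \<in> perms_with_ascents N j. \<not> parity_alternate a \<and> odd (card (inversions a))}"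
  have "bij_betw (parity_swap N) E O'"
    by (rule bij_betw_byWitness[of _ "parity_swap N"])
      (auto simp: E_def O'_def parity_swap_sign_reversing_involution[OF _ _ assms])
  then have "card E = card O'" by (rule bij_betw_same_card)
  moreover have "B_count N j = P_count N j + card E"
    unfolding B_count_def P_count_def paps_with_ascents_def E_def
    by (subst card_Un_disjoint[symmetric]) (auto intro!: arg_cong[of _ _ card])
  moreover have "C_count N j = Q_count N j + card O'"
    unfolding C_count_def Q_count_def paps_with_ascents_def O'_def
    by (subst card_Un_disjoint[symmetric]) (auto intro!: arg_cong[of _ _ card])
  ultimately show ?thesis by (simp add: D_diff_def R_diff_def)
qed

subsection \<open>Divisibility\<close>

text \<open>The parameter \<open>s\<close> selects the sign, covering both \<open>P_count\<close>
  and \<open>Q_count\<close>. The \<open>k - 1\<close> ascents together with the one leaving the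
  prefixed \<open>0\<close> give \<open>k\<close> cyclic ascents, which is where divisibility of
  \<open>k\<close> enters.\<close>

lemma prime_power_dvd_card_signed_paps:
  assumes "prime p" and "even n" and "n > 0" and "p ^ m dvd n" and "p dvd n" and "int p dvd k"
  shows "p ^ m dvd
    card {a \<in> paps_with_ascents (n - 1) (k - 1). even (card (inversions a)) \<longleftrightarrow> s}"
proof -
  define N where "N = n - 1"
  define X where "X = {a \<in> paps_with_ascents N (k - 1). even (card (inversions a)) \<longleftrightarrow> s}"
  have n: "n = Suc N" and "odd N" using assms by (auto simp: N_def)
  then have "N > 0" by (cases N) auto
  have X: "a \<in> permutations_of_set {1..N}" "int (Suc (card (ascents a))) = k" "parity_alternate a"
    if "a \<in> X" for a
    using that by (auto simp: X_def paps_with_ascents_def perms_with_ascents_def)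
  have "p ^ m dvd card X"
  proof (rule prime_power_dvd_card_of_cyclic_action[where f = "shift_up N" and n = n and p = p])
    show "finite X" by (simp add: X_def paps_with_ascents_def)
    show "shift_up N a \<in> X" if "a \<in> X" for a
      using that X[OF that] shift_up_in_permutations[of a N] card_ascents_shift_up[of a N]
        shift_up_parity[of a N] \<open>N > 0\<close> \<open>odd N\<close>
      by (auto simp: X_def paps_with_ascents_def perms_with_ascents_def)
    show "(shift_up N ^^ n) a = a" if "a \<in> X" for a
      unfolding n using X(1)[OF that] \<open>N > 0\<close> by (rule shift_up_funpow_period)
    show "(shift_up N ^^ (n div p)) a \<noteq> a" if "a \<in> X" for a
    proof (rule shift_up_funpow_fixed_point_free)
      show "Suc N = p * (n div p)" using assms(5) n by simp
      show "p dvd Suc (card (ascents a))"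
        using assms(6) X(2)[OF that] by (metis of_nat_dvd_iff)
    qed (use X(1)[OF that] \<open>N > 0\<close> prime_gt_1_nat[OF assms(1)] in auto)
  qed (use assms in auto)
  then show ?thesis by (simp add: X_def N_def)
qed

theorem theorem5p2:
  fixes p m n :: nat and k :: int
  assumes "prime p" and "m > 0" and "n > 0" and "even n" and "p ^ m dvd n"
    and "int p dvd k"
  shows "p ^ m dvd S_count (n - 1) (k - 1) \<and>
         p ^ m dvd P_count (n - 1) (k - 1) \<and>
         p ^ m dvd Q_count (n - 1) (k - 1) \<and>
         int (p ^ m) dvd R_diff (n - 1) (k - 1) \<and>
         int (p ^ m) dvd D_diff (n - 1) (k - 1)"
proof -
  have "p dvd n" using assms(2,5) by (metis dvd_power dvd_trans)
  note dvd = prime_power_dvd_card_signed_paps[OF assms(1,4,3,5) this assms(6)]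
  have P: "p ^ m dvd P_count (n - 1) (k - 1)"
    using dvd[of True] by (simp add: P_count_def)
  have Q: "p ^ m dvd Q_count (n - 1) (k - 1)"
    using dvd[of False] by (simp add: Q_count_def)
  have "S_count (n - 1) (k - 1) = P_count (n - 1) (k - 1) + Q_count (n - 1) (k - 1)"
    unfolding S_count_def P_count_def Q_count_def
    by (subst card_Un_disjoint[symmetric])
      (auto simp: paps_with_ascents_def intro!: arg_cong[of _ _ card])
  then have S: "p ^ m dvd S_count (n - 1) (k - 1)" using P Q by simp
  have R: "int (p ^ m) dvd R_diff (n - 1) (k - 1)"
    unfolding R_diff_def using P Q by (intro dvd_diff) (simp_all only: of_nat_dvd_iff)
  moreover have "D_diff (n - 1) (k - 1) = R_diff (n - 1) (k - 1)"
    using assms(3,4) by (intro D_diff_eq_R_diff) auto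
  ultimately show ?thesis using P Q S by simp
qed

end
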